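(* Let $X$ be a Banach space, let $F$ be an absolute normalized norm on $\mathbb{R}^2$ such that $(1,0)$ is an extreme point of the closed unit ball $B_{(\mathbb{R}^2,F^\ast)}$, where $F^\ast$ is the dual norm of $F$, and let $Y$ be an $F$-ideal in $X$. (a) If $X$ has the DD2P, then $Y$ has the DD2P. (b) If $X$ has the DLD2P, then $Y$ has the DLD2P.
   Context: All Banach spaces are real and nontrivial (i.e. $\neq\{0\}$). $B_X$, $S_X$, $X^\ast$ denote the closed unit ball, the unit sphere and the dual space of $X$. A slice of $B_X$ is a set of the form $S(B_X,x^\ast,\alpha)=\{x\in B_X: x^\ast(x)>1-\alpha\}$ with $x^\ast\in S_{X^\ast}$ and $\alpha>0$. $X$ has the diametral diameter two property (DD2P) if for every nonempty relatively weakly open subset $U$ of $B_X$, every $x\in U\cap S_X$ and every $\varepsilon>0$ there exists $y\in U$ with $\|x-y\|\ge 2-\varepsilon$. $X$ has the diametral local diameter two property (DLD2P) if for every slice $S$ of $B_X$, every $x\in S\cap S_X$ and every $\varepsilon>0$ there exists $y\in S$ with $\|x-y\|\ge 2-\varepsilon$. A norm $F$ on $\mathbb{R}^2$ is absolute if $F(a,b)=F(|a|,|b|)$ for all $(a,b)\in\mathbb{R}^2$, and normalized if $F(1,0)=F(0,1)=1$. The dual norm $F^\ast$ on $\mathbb{R}^2$ is $F^\ast(c,d)=\max_{F(a,b)\le 1}(|ac|+|bd|)$; it is again absolute and normalized. For a closed subspace $Y\subset X$, put $Y^\perp=\{x^\ast\in X^\ast: x^\ast(y)=0 \text{ for all }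 y\in Y\}$. A closed subspace $Y\subset X$ is an $F$-ideal in $X$ if there is a (linear) projection $P$ on $X^\ast$ with $\ker P=Y^\perp$ and $\|x^\ast\|=F^\ast(\|Px^\ast\|,\|x^\ast-Px^\ast\|)$ for all $x^\ast\in X^\ast$. *)

theory Defs
  imports "HOL-Analysis.Analysis"
begin

(* A (closed) linear subspace Y of the ambient space 'a is treated as a normed space in its own
   right; the ambient space itself is the case Y = UNIV.  A functional on Y is a function on 'a of
   which only the values on Y matter; it need not be linear or bounded off Y. *)

definition dual_space :: "'a::real_normed_vector set \<Rightarrow> ('a \<Rightarrow> real) set" where
  "dual_space Y = {f. (\<forall>x\<in>Y. \<forall>y\<in>Y. f (x + y) = f x + f y) \<and>
                      (\<forall>c. \<forall>x\<in>Y. f (c *\<^sub>R x) = c * f x) \<and>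
                      (\<exists>K. \<forall>x\<in>Y. \<bar>f x\<bar> \<le> K * norm x)}"

definition unit_ball :: "'a::real_normed_vector set \<Rightarrow> 'a set" where
  "unit_ball Y = {x \<in> Y. norm x \<le> 1}"

definition unit_sphere :: "'a::real_normed_vector set \<Rightarrow> 'a set" where
  "unit_sphere Y = {x \<in> Y. norm x = 1}"

definition dual_norm :: "'a::real_normed_vector set \<Rightarrow> ('a \<Rightarrow> real) \<Rightarrow> real" where
  "dual_norm Y f = (SUP x\<in>unit_ball Y. \<bar>f x\<bar>)"

definition weak_topology :: "'a::real_normed_vector set \<Rightarrow> 'a topology" where
  "weak_topology Y =
     topology_generated_by {{x \<in> Y. f x \<in> V} | f V. f \<in> dual_space Y \<and> open V}"

definition slice :: "'a::real_normed_vector set \<Rightarrow> ('a \<Rightarrow> real) \<Rightarrow> real \<Rightarrow> 'a set" where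
  "slice Y f \<alpha> = {x \<in> unit_ball Y. f x > 1 - \<alpha>}"

definition is_slice :: "'a::real_normed_vector set \<Rightarrow> 'a set \<Rightarrow> bool" where
  "is_slice Y S \<longleftrightarrow> (\<exists>f \<alpha>. f \<in> dual_space Y \<and> dual_norm Y f = 1 \<and> \<alpha> > 0 \<and> S = slice Y f \<alpha>)"

definition DD2P :: "'a::real_normed_vector set \<Rightarrow> bool" where
  "DD2P Y \<longleftrightarrow>
     (\<forall>U. openin (subtopology (weak_topology Y) (unit_ball Y)) U \<and> U \<noteq> {} \<longrightarrow>
       (\<forall>x \<in> U \<inter> unit_sphere Y. \<forall>\<epsilon>>0. \<exists>y\<in>U. norm (x - y) \<ge> 2 - \<epsilon>))"

definition DLD2P :: "'a::real_normed_vector set \<Rightarrow> bool" where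
  "DLD2P Y \<longleftrightarrow>
     (\<forall>S. is_slice Y S \<longrightarrow>
       (\<forall>x \<in> S \<inter> unit_sphere Y. \<forall>\<epsilon>>0. \<exists>y\<in>S. norm (x - y) \<ge> 2 - \<epsilon>))"

definition norm_on_R2 :: "(real \<times> real \<Rightarrow> real) \<Rightarrow> bool" where
  "norm_on_R2 F \<longleftrightarrow>
     (\<forall>p. F p \<ge> 0) \<and> (\<forall>p. F p = 0 \<longleftrightarrow> p = 0) \<and>
     (\<forall>c p. F (c *\<^sub>R p) = \<bar>c\<bar> * F p) \<and> (\<forall>p q. F (p + q) \<le> F p + F q)"

definition absolute_normalized_norm :: "(real \<times> real \<Rightarrow> real) \<Rightarrow> bool" where
  "absolute_normalized_norm F \<longleftrightarrow>
     norm_on_R2 F \<and> (\<forall>a b. F (a, b) = F (\<bar>a\<bar>, \<bar>b\<bar>)) \<and> F (1, 0) = 1 \<and> F (0, 1) = 1"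

(* For a norm F the supremum is attained, the unit ball of F being compact. *)
definition dual_norm_R2 :: "(real \<times> real \<Rightarrow> real) \<Rightarrow> real \<times> real \<Rightarrow> real" where
  "dual_norm_R2 F = (\<lambda>(c, d). SUP (a, b)\<in>{p. F p \<le> 1}. \<bar>a * c\<bar> + \<bar>b * d\<bar>)"

definition annihilator :: "'a::real_normed_vector set \<Rightarrow> ('a \<Rightarrow>\<^sub>L real) set" where
  "annihilator Y = {f. \<forall>y\<in>Y. blinfun_apply f y = 0}"

definition F_ideal :: "(real \<times> real \<Rightarrow> real) \<Rightarrow> 'a::real_normed_vector set \<Rightarrow> bool" where
  "F_ideal F Y \<longleftrightarrow>
     subspace Y \<and> closed Y \<and>
     (\<exists>P :: ('a \<Rightarrow>\<^sub>L real) \<Rightarrow> ('a \<Rightarrow>\<^sub>L real).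
        linear P \<and> (\<forall>f. P (P f) = P f) \<and> {f. P f = 0} = annihilator Y \<and>
        (\<forall>f. norm f = dual_norm_R2 F (norm (P f), norm (f - P f))))"

(* For Y = UNIV the dual space and its norm are the usual ones. *)

lemma dual_space_UNIV: "dual_space UNIV = Collect bounded_linear"
proof (intro set_eqI iffI)
  fix f :: "'a \<Rightarrow> real" assume "f \<in> dual_space UNIV"
  then obtain K where "\<And>x y. f (x + y) = f x + f y" "\<And>c x. f (c *\<^sub>R x) = c * f x"
    "\<And>x. \<bar>f x\<bar> \<le> K * norm x"
    by (auto simp: dual_space_def)
  then show "f \<in> Collect bounded_linear"
    by (auto intro!: bounded_linear_intro[where K = K] simp: mult.commute)
next
  fix f :: "'a \<Rightarrow> real" assume "f \<in> Collect bounded_linear"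
  then interpret f: bounded_linear f by simp
  obtain K where "\<And>x. norm (f x) \<le> norm x * K"
    using f.bounded by blast
  then show "f \<in> dual_space UNIV"
    by (auto simp: dual_space_def f.add f.scaleR mult.commute intro!: exI[of _ K])
qed

lemma dual_norm_UNIV:
  fixes f :: "'a::real_normed_vector \<Rightarrow>\<^sub>L real"
  shows "dual_norm UNIV (blinfun_apply f) = norm f"
proof -
  have ub: "\<bar>blinfun_apply f x\<bar> \<le> norm f" if "x \<in> unit_ball UNIV" for x
  proof -
    have "\<bar>blinfun_apply f x\<bar> \<le> norm f * norm x"
      using norm_blinfun[of f x] by simp
    also have "\<dots> \<le> norm f * 1"
      using that by (intro mult_left_mono) (auto simp: unit_ball_def)
    finally show ?thesis by simp
  qed
  have bdd: "bdd_above ((\<lambda>x. \<bar>blinfun_apply f x\<bar>) ` unit_ball UNIV)"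
    using ub by (auto intro!: bdd_aboveI)
  have le: "\<bar>blinfun_apply f x\<bar> \<le> dual_norm UNIV (blinfun_apply f)" if "norm x \<le> 1" for x
    unfolding dual_norm_def by (rule cSUP_upper[OF _ bdd]) (simp add: unit_ball_def that)
  have "norm f \<le> dual_norm UNIV (blinfun_apply f)"
  proof (rule norm_blinfun_bound)
    show "0 \<le> dual_norm UNIV (blinfun_apply f)"
      using le[of 0] by (simp add: blinfun.zero_right)
    fix x :: 'a
    show "norm (blinfun_apply f x) \<le> dual_norm UNIV (blinfun_apply f) * norm x"
      using le[of "x /\<^sub>R norm x"]
      by (cases "x = 0") (auto simp: blinfun.zero_right blinfun.scaleR_right abs_mult field_simps)
  qed
  moreover have "dual_norm UNIV (blinfun_apply f) \<le> norm f"
    unfolding dual_norm_def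
  proof (rule cSUP_least)
    show "unit_ball (UNIV :: 'a set) \<noteq> {}"
      by (auto simp: unit_ball_def intro!: exI[of _ 0])
  qed (rule ub)
  ultimately show ?thesis by simp
qed

lemma topspace_weak_topology: "topspace (weak_topology Y) = Y"
proof -
  have "Y = {x \<in> Y. (\<lambda>_. 0::real) x \<in> UNIV}" "(\<lambda>_. 0) \<in> dual_space Y"
    by (auto simp: dual_space_def intro!: exI[of _ 0])
  then have "Y \<in> {{x \<in> Y. f x \<in> V} | f V. f \<in> dual_space Y \<and> open V}"
    using open_UNIV by blast
  then show ?thesis
    unfolding weak_topology_def topology_generated_by_topspace by blast
qed

end

theory Submission
  imports Defs
begin

text \<open>Let \<open>x\<close> be a norm-one element of \<open>Y\<close>. The range of the ideal projection \<open>P\<close> is isometric to the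
  dual of \<open>Y\<close>, so a relatively weakly open set (or slice) of the ball of \<open>Y\<close> around \<open>x\<close> extends to one
  of the ball of \<open>X\<close>, which contains some \<open>z\<close> with \<open>\<parallel>x - z\<parallel>\<close> close to \<open>2\<close>. If \<open>g\<close> norms \<open>x - z\<close>, then
  \<open>(P g) x = g x\<close> is close to \<open>1\<close>, and since \<open>(1, 0)\<close> is extreme, \<open>\<parallel>g - P g\<parallel>\<close> is small; so \<open>P g\<close> almost
  norms \<open>x - z\<close>. A point \<open>y\<close> of the ball of \<open>Y\<close> on which the finitely many functionals in question,
  including \<open>P g\<close>, take nearly the same values as on \<open>z\<close> is then in the given set and far from \<open>x\<close>.\<close>

subsection \<open>The Hahn--Banach theorem\<close>

definition sublinear :: "('a::real_vector \<Rightarrow> real) \<Rightarrow> bool" where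
  "sublinear p \<longleftrightarrow> (\<forall>x y. p (x + y) \<le> p x + p y) \<and> (\<forall>c\<ge>0. \<forall>x. p (c *\<^sub>R x) = c * p x)"

text \<open>One inequality for positive \<open>c\<close> suffices: applied to
  \<open>inverse c\<close> and \<open>c *\<^sub>R x\<close> it gives the reverse one.\<close>

lemma sublinearI:
  assumes "\<And>x y. p (x + y) \<le> p x + p y" "p 0 = 0" "\<And>c x. c > 0 \<Longrightarrow> p (c *\<^sub>R x) \<le> c * p x"
  shows "sublinear p"
proof -
  have "p (c *\<^sub>R x) = c * p x" if "c \<ge> 0" for c x
  proof (cases "c = 0")
    case False
    then have "c > 0" using that by simp
    then have "p (inverse c *\<^sub>R c *\<^sub>R x) \<le> inverse c * p (c *\<^sub>R x)"
      by (intro assms) simp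
    then have "c * p x \<le> p (c *\<^sub>R x)"
      using \<open>c > 0\<close> by (simp add: field_simps)
    then show ?thesis using assms(3)[OF \<open>c > 0\<close>, of x] by simp
  qed (simp add: assms)
  then show ?thesis using assms(1) by (simp add: sublinear_def)
qed

lemma sublinear_add: "sublinear p \<Longrightarrow> p (x + y) \<le> p x + p y"
  and sublinear_scaleR: "sublinear p \<Longrightarrow> c \<ge> 0 \<Longrightarrow> p (c *\<^sub>R x) = c * p x"
  by (auto simp: sublinear_def)

lemma sublinear_zero: "sublinear p \<Longrightarrow> p 0 = 0"
  using sublinear_scaleR[of p 0 0] by simp

lemma sublinear_minus: "sublinear p \<Longrightarrow> - p (- x) \<le> p x"
  using sublinear_add[of p x "- x"] sublinear_zero[of p] by simp

lemma sublinear_norm: "K \<ge> 0 \<Longrightarrow> sublinear (\<lambda>x. K * norm x)"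
  by (auto simp: sublinear_def distrib_left[symmetric] intro!: mult_left_mono norm_triangle_ineq)

text \<open>The infimal convolution of \<open>p\<close> with a cone of constraints \<open>(y, r)\<close>, each to be read as
  the value at \<open>y\<close> is at most \<open>r\<close>.\<close>

lemma sublinear_constrain:
  fixes A :: "('a::real_vector \<times> real) set"
  assumes p: "sublinear p" and cone: "(0, 0) \<in> A"
    and add: "\<And>u v. u \<in> A \<Longrightarrow> v \<in> A \<Longrightarrow> u + v \<in> A"
    and scale: "\<And>c u. c > 0 \<Longrightarrow> u \<in> A \<Longrightarrow> c *\<^sub>R u \<in> A"
    and dom: "\<And>y r. (y, r) \<in> A \<Longrightarrow> - r \<le> p (- y)"
  obtains q where "sublinear q" "q \<le> p" "\<And>y r. (y, r) \<in> A \<Longrightarrow> q y \<le> r"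
proof -
  define q where "q x = (INF u\<in>A. snd u + p (x - fst u))" for x
  \<comment> \<open>The hypothesis \<open>dom\<close> makes the infimum finite: subadditivity splits
    \<open>p (- fst u)\<close> into \<open>p (x - fst u)\<close> and \<open>p (- x)\<close>.\<close>
  have "- p (- x) \<le> snd u + p (x - fst u)" if "u \<in> A" for x u
    using dom[of "fst u" "snd u"] that sublinear_add[OF p, of "x - fst u" "- x"] by simp
  then have bdd: "bdd_below ((\<lambda>u. snd u + p (x - fst u)) ` A)" for x
    by (intro bdd_belowI2) auto
  have le: "q x \<le> r + p (x - y)" if "(y, r) \<in> A" for x y r
    unfolding q_def using cINF_lower[OF bdd that, of x] by simp
  have ge: "m \<le> q x" if "\<And>y r. (y, r) \<in> A \<Longrightarrow> m \<le> r + p (x - y)" for m x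
    unfolding q_def using cone that by (intro cINF_greatest) auto
  have "sublinear q"
  proof (rule sublinearI)
    fix x x'
    have "q (x + x') - q x \<le> q x'"
    proof (rule ge)
      fix y' r' assume 1: "(y', r') \<in> A"
      have "q (x + x') - (r' + p (x' - y')) \<le> q x"
      proof (rule ge)
        fix y r assume "(y, r) \<in> A"
        then have "q (x + x') \<le> (r + r') + p (x + x' - (y + y'))"
          using add[OF _ 1] by (intro le) fastforce
        also have "\<dots> \<le> (r + r') + (p (x - y) + p (x' - y'))"
          using sublinear_add[OF p, of "x - y" "x' - y'"] by (simp add: algebra_simps)
        finally show "q (x + x') - (r' + p (x' - y')) \<le> r + p (x - y)" by simp
      qed
      then show "q (x + x') - q x \<le> r' + p (x' - y')" by simp
    qed
    then show "q (x + x') \<le> q x + q x'" by simp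
  next
    have "0 \<le> q 0" using dom by (intro ge) fastforce
    then show "q 0 = 0" using le[OF cone, of 0] sublinear_zero[OF p] by simp
  next
    fix c :: real and x assume c: "c > 0"
    have "q (c *\<^sub>R x) / c \<le> q x"
    proof (rule ge)
      fix y r assume "(y, r) \<in> A"
      then have "q (c *\<^sub>R x) \<le> c * r + p (c *\<^sub>R x - c *\<^sub>R y)"
        using scale[OF c] by (intro le) fastforce
      also have "\<dots> = c * (r + p (x - y))"
        using sublinear_scaleR[OF p, of c "x - y"] c by (simp add: algebra_simps)
      finally show "q (c *\<^sub>R x) / c \<le> r + p (x - y)" using c by (simp add: field_simps)
    qed
    then show "q (c *\<^sub>R x) \<le> c * q x" using c by (simp add: field_simps)
  qed
  moreover have "q \<le> p" using le[OF cone] by (simp add: le_fun_def)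
  moreover have "q y \<le> r" if "(y, r) \<in> A" for y r
    using le[OF that, of y] sublinear_zero[OF p] by simp
  ultimately show ?thesis using that by blast
qed

text \<open>Zorn's lemma, with pointwise infima as lower bounds of chains. Below \<open>p\<close>
  every sublinear \<open>q\<close> satisfies \<open>- p (- x) \<le> q x\<close>, so these infima are
  finite.\<close>

lemma sublinear_minimal:
  assumes p: "sublinear p"
  obtains q where "sublinear q" "q \<le> p" "\<And>q'. sublinear q' \<Longrightarrow> q' \<le> q \<Longrightarrow> q' = q"
proof -
  define S where "S = {q. sublinear q \<and> q \<le> p}"
  have "\<exists>m\<in>S. \<forall>a\<in>S. a \<le> m \<longrightarrow> a = m"
  proof (rule predicate_Zorn)
    \<comment> \<open>The order is reversed, so that a maximal element for Zorn's lemma is a minimal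
      functional.\<close>
    show "partial_order_on S (relation_of (\<lambda>q q'. q' \<le> q) S)"
      by (rule partial_order_on_relation_ofI) auto
  next
    fix C assume C: "C \<in> Chains (relation_of (\<lambda>q q'. q' \<le> q) S)"
    then have sub: "C \<subseteq> S" and chain: "\<And>a b. a \<in> C \<Longrightarrow> b \<in> C \<Longrightarrow> a \<le> b \<or> b \<le> a"
      by (auto simp: Chains_def relation_of_def)
    show "\<exists>u\<in>S. \<forall>a\<in>C. u \<le> a"
    proof (cases "C = {}")
      case True
      then show ?thesis using p by (auto simp: S_def)
    next
      case False
      define u where "u x = (INF q\<in>C. q x)" for x
      have sl: "sublinear q" and lep: "q x \<le> p x" if "q \<in> C" for q x
        using that sub by (auto simp: S_def le_fun_def)
      have "- p (- x) \<le> q x" if "q \<in> C" for q x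
        using sublinear_minus[OF sl[OF that], of x] lep[OF that, of "- x"] by linarith
      then have "bdd_below ((\<lambda>q. q x) ` C)" for x
        by (intro bdd_belowI2) auto
      then have le: "u x \<le> q x" if "q \<in> C" for q x
        unfolding u_def using that by (intro cINF_lower)
      have ge: "m \<le> u x" if "\<And>q. q \<in> C \<Longrightarrow> m \<le> q x" for m x
        unfolding u_def using False that by (intro cINF_greatest) auto
      have "sublinear u"
      proof (rule sublinearI)
        fix x y
        have "u (x + y) - u x \<le> u y"
        proof (rule ge)
          fix q assume q: "q \<in> C"
          have "u (x + y) - q y \<le> u x"
          proof (rule ge)
            fix q' assume q': "q' \<in> C"
            show "u (x + y) - q y \<le> q' x"
            \<comment> \<open>Infima of sublinear functionals need not be subadditive; in a chain,
              the smaller of \<open>q\<close> and \<open>q'\<close> can serve for both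
              summands.\<close>
            proof (cases "q \<le> q'")
              case True
              have "u (x + y) \<le> q x + q y"
                using le[OF q, of "x + y"] sublinear_add[OF sl[OF q], of x y] by linarith
              then show ?thesis using le_funD[OF True, of x] by linarith
            next
              case False
              then have "q' y \<le> q y" using chain[OF q q'] by (auto simp: le_fun_def)
              then show ?thesis
                using le[OF q', of "x + y"] sublinear_add[OF sl[OF q'], of x y] by linarith
            qed
          qed
          then show "u (x + y) - u x \<le> q y" by simp
        qed
        then show "u (x + y) \<le> u x + u y" by simp
      next
        obtain q where "q \<in> C" using False by blast
        then have "u 0 \<le> 0" using le[of q 0] sublinear_zero[OF sl[of q]] by simp
        moreover have "0 \<le> u 0" by (intro ge) (simp add: sublinear_zero[OF sl])
        ultimately show "u 0 = 0" by simp
      next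
        fix c :: real and x assume c: "c > 0"
        have "u (c *\<^sub>R x) / c \<le> u x"
        proof (rule ge)
          fix q assume "q \<in> C"
          then show "u (c *\<^sub>R x) / c \<le> q x"
            using le[of q "c *\<^sub>R x"] sublinear_scaleR[OF sl, of q c x] c by (simp add: field_simps)
        qed
        then show "u (c *\<^sub>R x) \<le> c * u x" using c by (simp add: field_simps)
      qed
      moreover have "u \<le> p"
        using False le lep by (fastforce simp: le_fun_def intro: order_trans)
      ultimately show ?thesis using le by (auto simp: S_def le_fun_def)
    qed
  qed
  then obtain m where m: "m \<in> S" "\<And>a. a \<in> S \<Longrightarrow> a \<le> m \<Longrightarrow> a = m" by blast
  show ?thesis
  proof
    show "sublinear m" "m \<le> p" using m by (auto simp: S_def)
    fix q' assume "sublinear q'" "q' \<le> m"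
    then show "q' = m" using m \<open>m \<le> p\<close> by (intro m) (auto simp: S_def)
  qed
qed

text \<open>A minimal sublinear functional is odd: constraining it at \<open>- y\<close> by \<open>- q y\<close> gives no smaller one.\<close>

lemma linear_minorant:
  assumes "sublinear p"
  obtains g where "linear g" "g \<le> p"
proof -
  obtain q where q: "sublinear q" "q \<le> p" and min: "\<And>q'. sublinear q' \<Longrightarrow> q' \<le> q \<Longrightarrow> q' = q"
    using sublinear_minimal[OF assms] by blast
  have odd: "q (- y) = - q y" for y
  proof -
    let ?A = "(\<lambda>t. (t *\<^sub>R (- y), t * (- q y))) ` {0..}"
    obtain q' where q': "sublinear q'" "q' \<le> q" "\<And>z r. (z, r) \<in> ?A \<Longrightarrow> q' z \<le> r"
    proof (rule sublinear_constrain[OF q(1), of ?A])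
      show "(0, 0) \<in> ?A" by (rule image_eqI[of _ _ 0]) auto
      show "u + v \<in> ?A" if uv: "u \<in> ?A" "v \<in> ?A" for u v
      proof -
        obtain s t where "s \<ge> 0" "t \<ge> 0" "u = (s *\<^sub>R (- y), s * (- q y))"
          "v = (t *\<^sub>R (- y), t * (- q y))" using uv by auto
        then show ?thesis by (intro image_eqI[of _ _ "s + t"]) (auto simp: algebra_simps)
      qed
      show "c *\<^sub>R u \<in> ?A" if cu: "c > 0" "u \<in> ?A" for c u
      proof -
        obtain t where "t \<ge> 0" "u = (t *\<^sub>R (- y), t * (- q y))" using cu by auto
        then show ?thesis using cu by (intro image_eqI[of _ _ "c * t"]) auto
      qed
      \<comment> \<open>On this ray the domination condition holds with equality.\<close>
      show "- r \<le> q (- z)" if "(z, r) \<in> ?A" for z r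
        using that sublinear_scaleR[OF q(1), of _ y] by auto
    qed blast
    have "q' (- y) \<le> - q y" by (rule q'(3)) (rule image_eqI[of _ _ 1], auto)
    \<comment> \<open>Minimality forces \<open>q' = q\<close>, hence
      \<open>q (- y) \<le> - q y\<close>; the opposite inequality holds for every sublinear
      functional.\<close>
    then show ?thesis
      using min[OF q'(1,2)] sublinear_minus[OF q(1), of "y"] by simp
  qed
  have "linear q"
  proof (rule linearI)
    show "q (x + y) = q x + q y" for x y
      using sublinear_add[OF q(1), of x y] sublinear_add[OF q(1), of "x + y" "- y"] odd[of y] by simp
    show "q (c *\<^sub>R x) = c *\<^sub>R q x" for c x
    proof (cases "c \<ge> 0")
      case False
      then show ?thesis
        using sublinear_scaleR[OF q(1), of "- c" x] odd[of "c *\<^sub>R x"] by simp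
    qed (simp add: sublinear_scaleR[OF q(1)])
  qed
  then show ?thesis using q(2) that by blast
qed

section \<open>Bounded functionals under linear constraints\<close>

text \<open>A linear minorant of the constrained \<open>K * norm\<close> obeys the constraints and,
  being odd, is bounded by \<open>K\<close> on both sides. Extension and norming functionals arise
  from suitable cones \<open>A\<close>.\<close>

theorem Hahn_Banach_cone:
  fixes A :: "('a::real_normed_vector \<times> real) set"
  assumes K: "K \<ge> 0" and cone: "(0, 0) \<in> A" "\<And>u v. u \<in> A \<Longrightarrow> v \<in> A \<Longrightarrow> u + v \<in> A"
      "\<And>c u. c > 0 \<Longrightarrow> u \<in> A \<Longrightarrow> c *\<^sub>R u \<in> A"
    and dom: "\<And>y r. (y, r) \<in> A \<Longrightarrow> - r \<le> K * norm y"
  obtains g :: "'a \<Rightarrow>\<^sub>L real" where "norm g \<le> K" "\<And>y r. (y, r) \<in> A \<Longrightarrow> g y \<le> r"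
proof -
  obtain q where q: "sublinear q" "q \<le> (\<lambda>x. K * norm x)" "\<And>y r. (y, r) \<in> A \<Longrightarrow> q y \<le> r"
  proof (rule sublinear_constrain[OF sublinear_norm[OF K] cone])
    show "- r \<le> K * norm (- y)" if "(y, r) \<in> A" for y r
      using dom[OF that] by simp
  qed blast+
  obtain g where g: "linear g" "g \<le> q" using linear_minorant[OF q(1)] .
  have le: "g x \<le> K * norm x" for x
    using g(2) q(2) by (auto simp: le_fun_def intro: order_trans)
  have bd: "norm (g x) \<le> K * norm x" for x
    using le[of x] le[of "- x"] linear_neg[OF g(1)] by (simp add: abs_le_iff)
  have bl: "bounded_linear g"
    using g(1) bd by (intro bounded_linear_intro[where K = K])
      (auto simp: linear_add linear_scale mult.commute)
  show ?thesis
  proof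
    show "norm (Blinfun g) \<le> K"
      using bd by (intro norm_blinfun_bound K) (simp add: bounded_linear_Blinfun_apply[OF bl])
    show "Blinfun g y \<le> r" if "(y, r) \<in> A" for y r
      using q(3)[OF that] g(2) by (auto simp: bounded_linear_Blinfun_apply[OF bl] le_fun_def intro: order_trans)
  qed
qed

text \<open>The cone is the graph of \<open>f\<close> on \<open>Y\<close>. The constraints say only
  \<open>g \<le> f\<close> there, and the values at \<open>- y\<close> turn this into
  equality.\<close>

corollary Hahn_Banach_extension:
  fixes Y :: "'a::real_normed_vector set"
  assumes Y: "subspace Y" and K: "K \<ge> 0"
    and add: "\<And>x y. x \<in> Y \<Longrightarrow> y \<in> Y \<Longrightarrow> f (x + y) = f x + f y"
    and scale: "\<And>c x. x \<in> Y \<Longrightarrow> f (c *\<^sub>R x) = c * f x"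
    and bd: "\<And>x. x \<in> Y \<Longrightarrow> \<bar>f x\<bar> \<le> K * norm x"
  obtains g :: "'a \<Rightarrow>\<^sub>L real" where "norm g \<le> K" "\<And>y. y \<in> Y \<Longrightarrow> g y = f y"
proof -
  let ?A = "(\<lambda>y. (y, f y)) ` Y"
  obtain g :: "'a \<Rightarrow>\<^sub>L real" where g: "norm g \<le> K" "\<And>y r. (y, r) \<in> ?A \<Longrightarrow> g y \<le> r"
  proof (rule Hahn_Banach_cone[OF K, of ?A])
    have "f 0 = 0" using scale[of 0 0] subspace_0[OF Y] by simp
    then show "(0, 0) \<in> ?A" using subspace_0[OF Y] by force
    show "u + v \<in> ?A" if "u \<in> ?A" "v \<in> ?A" for u v
      using that add subspace_add[OF Y] by force
    show "c *\<^sub>R u \<in> ?A" if "u \<in> ?A" for c u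
      using that scale subspace_scale[OF Y] by force
    show "- r \<le> K * norm y" if "(y, r) \<in> ?A" for y r
      using that bd[of y] by auto
  qed blast
  have le: "g y \<le> f y" if "y \<in> Y" for y using g(2) that by blast
  have "g y = f y" if "y \<in> Y" for y
  proof -
    have "g (- y) \<le> f (- y)" using le subspace_neg[OF Y that] by blast
    then show ?thesis using le[OF that] scale[OF that, of "-1"] by (simp add: blinfun.minus_right)
  qed
  then show ?thesis using g(1) that by blast
qed

text \<open>The cone is the line through \<open>(v, norm v)\<close>; its points for the coefficients
  1 and -1 bound \<open>g v\<close> from both sides. The case \<open>v = 0\<close> needs no separate
  treatment.\<close>

corollary norming_functional:
  fixes v :: "'a::real_normed_vector"
  obtains g :: "'a \<Rightarrow>\<^sub>L real" where "norm g \<le> 1" "g v = norm v"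
proof -
  let ?A = "range (\<lambda>c. (c *\<^sub>R v, c * norm v))"
  obtain g :: "'a \<Rightarrow>\<^sub>L real" where g: "norm g \<le> 1" "\<And>y r. (y, r) \<in> ?A \<Longrightarrow> g y \<le> r"
  proof (rule Hahn_Banach_cone[of 1 ?A])
    show "(0, 0) \<in> ?A" by (rule image_eqI[of _ _ 0]) auto
    show "u + v' \<in> ?A" if uv: "u \<in> ?A" "v' \<in> ?A" for u v'
    proof -
      obtain s t where "u = (s *\<^sub>R v, s * norm v)" "v' = (t *\<^sub>R v, t * norm v)"
        using uv by auto
      then show ?thesis by (intro image_eqI[of _ _ "s + t"]) (auto simp: algebra_simps)
    qed
    show "c *\<^sub>R u \<in> ?A" if u: "u \<in> ?A" for c u
    proof -
      obtain t where "u = (t *\<^sub>R v, t * norm v)" using u by auto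
      then show ?thesis by (intro image_eqI[of _ _ "c * t"]) auto
    qed
    show "- r \<le> 1 * norm y" if "(y, r) \<in> ?A" for y r
      using that mult_right_mono[OF abs_ge_minus_self norm_ge_zero[of v]] by auto
  qed auto
  have "g (- v) \<le> - norm v" by (rule g(2)) (rule image_eqI[of _ _ "-1"], auto)
  moreover have "g v \<le> norm v" by (rule g(2)) (rule image_eqI[of _ _ 1], auto)
  ultimately show ?thesis using g(1) that[of g] by (simp add: blinfun.minus_right)
qed

subsection \<open>Approximation by elements of a convex set\<close>

text \<open>Helly's condition: otherwise, at a near-minimiser \<open>w\<close> over \<open>C\<close> of the squared distance
  \<open>\<Sum>f\<in>G. (f w - a f)\<^sup>2\<close>, the combination with coefficients \<open>a f - f w\<close> separates \<open>a\<close> from the image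
  of \<open>C\<close>.\<close>

lemma Helly_approximation:
  fixes G :: "('a::real_vector \<Rightarrow> real) set"
  assumes C: "convex C" "C \<noteq> {}" and G: "finite G"
    and lin: "\<And>f. f \<in> G \<Longrightarrow> linear f" and bd: "\<And>f y. f \<in> G \<Longrightarrow> y \<in> C \<Longrightarrow> \<bar>f y\<bar> \<le> M"
    and helly: "\<And>c B. (\<And>y. y \<in> C \<Longrightarrow> (\<Sum>f\<in>G. c f * f y) \<le> B) \<Longrightarrow> (\<Sum>f\<in>G. c f * a f) \<le> B"
    and \<eta>: "\<eta> > 0"
  obtains y where "y \<in> C" "\<And>f. f \<in> G \<Longrightarrow> \<bar>f y - a f\<bar> < \<eta>"
proof (rule ccontr)
  assume "\<not> thesis"
  then have far: "\<exists>f\<in>G. \<eta> \<le> \<bar>f y - a f\<bar>" if "y \<in> C" for y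
    using that \<open>\<And>y. \<lbrakk>y \<in> C; \<And>f. f \<in> G \<Longrightarrow> \<bar>f y - a f\<bar> < \<eta>\<rbrakk> \<Longrightarrow> thesis\<close> not_le by blast
  define \<Phi> where "\<Phi> y = (\<Sum>f\<in>G. (a f - f y)\<^sup>2)" for y
  have \<Phi>: "\<eta>\<^sup>2 \<le> \<Phi> y" if y: "y \<in> C" for y
  proof -
    obtain f where f: "f \<in> G" "\<eta> \<le> \<bar>f y - a f\<bar>" using far[OF y] by blast
    have "\<eta>\<^sup>2 \<le> (a f - f y)\<^sup>2" using f \<eta> by (simp add: abs_le_square_iff[symmetric] abs_minus_commute)
    also have "\<dots> \<le> \<Phi> y" unfolding \<Phi>_def using f G by (intro member_le_sum) auto
    finally show ?thesis .
  qed
  define d where "d = (INF y\<in>C. \<Phi> y)"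
  have bdd: "bdd_below (\<Phi> ` C)" using \<Phi> by (intro bdd_belowI2) auto
  have d_le: "d \<le> \<Phi> y" if "y \<in> C" for y
    unfolding d_def using bdd that by (rule cINF_lower)
  have d_ge: "\<eta>\<^sup>2 \<le> d" unfolding d_def using C(2) \<Phi> by (rule cINF_greatest)
  \<comment> \<open>\<open>N\<close> bounds the sum of the \<open>(f y - f w)\<^sup>2\<close>; the
    summand 1 keeps it positive as a divisor.\<close>
  define N where "N = 1 + 4 * M\<^sup>2 * card G"
  have N: "N \<ge> 1" by (simp add: N_def)
  \<comment> \<open>Step length from \<open>w\<close> towards \<open>y\<close>. The quadratic term
    and the slack in the choice of \<open>w\<close> are both at most
    \<open>t * \<eta>\<^sup>2 / 2\<close>, so each leaves \<open>\<eta>\<^sup>2 / 2\<close> after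
    division by \<open>t\<close>.\<close>
  define t where "t = min 1 (\<eta>\<^sup>2 / (2 * N))"
  have t: "0 < t" "t \<le> 1" "t * N \<le> \<eta>\<^sup>2 / 2"
    using \<eta> N by (auto simp: t_def min_def field_simps)
  obtain w where w: "w \<in> C" "\<Phi> w < d + t * \<eta>\<^sup>2 / 2"
    using cINF_less_iff[OF C(2) bdd, of "d + t * \<eta>\<^sup>2 / 2"] t \<eta> by (auto simp: d_def)
  define c where "c f = a f - f w" for f
  have "(\<Sum>f\<in>G. c f * f y) \<le> (\<Sum>f\<in>G. c f * f w) + \<eta>\<^sup>2 / 2" if y: "y \<in> C" for y
  proof -
    define u where "u = (1 - t) *\<^sub>R w + t *\<^sub>R y"
    have "u \<in> C" unfolding u_def using C(1) w(1) y t by (simp add: convex_alt)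
    have fu: "a f - f u = c f - t * (f y - f w)" if "f \<in> G" for f
    proof -
      have "f u = (1 - t) * f w + t * f y"
        unfolding u_def using lin[OF that] by (simp add: linear_add linear_scale)
      then show ?thesis by (simp add: c_def algebra_simps)
    qed
    have "(f y - f w)\<^sup>2 \<le> 4 * M\<^sup>2" if "f \<in> G" for f
    proof -
      have "\<bar>f y - f w\<bar> \<le> 2 * M" using bd[OF that y] bd[OF that w(1)] by linarith
      then show ?thesis using abs_le_square_iff[of "f y - f w" "2 * M"] by simp
    qed
    then have "(\<Sum>f\<in>G. (f y - f w)\<^sup>2) \<le> (\<Sum>f\<in>G. 4 * M\<^sup>2)" by (rule sum_mono)
    then have S: "(\<Sum>f\<in>G. (f y - f w)\<^sup>2) \<le> N" by (simp add: N_def algebra_simps)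
    have "d \<le> (\<Sum>f\<in>G. (c f - t * (f y - f w))\<^sup>2)"
      using d_le[OF \<open>u \<in> C\<close>] fu by (simp add: \<Phi>_def)
    also have "\<dots> = \<Phi> w - 2 * t * (\<Sum>f\<in>G. c f * (f y - f w)) + t\<^sup>2 * (\<Sum>f\<in>G. (f y - f w)\<^sup>2)"
      unfolding \<Phi>_def c_def[symmetric] sum_distrib_left sum_subtractf[symmetric] sum.distrib[symmetric]
      by (rule sum.cong) (simp_all add: power2_eq_square algebra_simps)
    also have "\<dots> \<le> d + t * \<eta>\<^sup>2 / 2 - 2 * t * (\<Sum>f\<in>G. c f * (f y - f w)) + t\<^sup>2 * N"
      using w(2) mult_left_mono[OF S, of "t\<^sup>2"] by simp
    finally have "t * (2 * (\<Sum>f\<in>G. c f * (f y - f w))) \<le> t * (\<eta>\<^sup>2 / 2 + t * N)"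
      by (simp add: algebra_simps power2_eq_square)
    then have "2 * (\<Sum>f\<in>G. c f * (f y - f w)) \<le> \<eta>\<^sup>2 / 2 + t * N"
      using t(1) by (simp only: mult_le_cancel_left_pos)
    then have "2 * (\<Sum>f\<in>G. c f * (f y - f w)) \<le> 2 * (\<eta>\<^sup>2 / 2)"
      using t(3) by simp
    then show ?thesis by (simp add: right_diff_distrib[of "c _"] sum_subtractf)
  qed
  then have "(\<Sum>f\<in>G. c f * a f) \<le> (\<Sum>f\<in>G. c f * f w) + \<eta>\<^sup>2 / 2"
    by (rule helly)
  \<comment> \<open>Since \<open>c f = a f - f w\<close>, the gap between the two sums is exactly
    the squared distance, which is at least \<open>\<eta>\<^sup>2\<close>.\<close>
  moreover have "\<Phi> w = (\<Sum>f\<in>G. c f * a f) - (\<Sum>f\<in>G. c f * f w)"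
    by (simp add: \<Phi>_def c_def power2_eq_square sum_subtractf[symmetric] algebra_simps)
  ultimately have "\<Phi> w \<le> \<eta>\<^sup>2 / 2" by simp
  then show False using \<Phi>[OF w(1)] \<eta> by (smt (verit) field_sum_of_halves zero_less_power)
qed

subsection \<open>Absolute norms on the plane\<close>

text \<open>Adding \<open>(a, b)\<close> to its reflection in a coordinate axis isolates one
  coordinate, doubled, and both points have the same norm.\<close>

lemma absolute_normalized_norm_bounds_coordinates:
  assumes "absolute_normalized_norm F" "F (a, b) \<le> 1"
  shows "\<bar>a\<bar> \<le> 1" "\<bar>b\<bar> \<le> 1"
proof -
  have tri: "F (p + q) \<le> F p + F q" and hom: "F (r *\<^sub>R p) = \<bar>r\<bar> * F p" for r p q
    using assms(1) unfolding absolute_normalized_norm_def norm_on_R2_def by blast+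
  have abs: "F (x, y) = F (\<bar>x\<bar>, \<bar>y\<bar>)" for x y
    using assms(1) unfolding absolute_normalized_norm_def by blast
  have F1: "F (1, 0) = 1" "F (0, 1) = 1"
    using assms by (auto simp: absolute_normalized_norm_def)
  have 1: "F (a, - b) = F (a, b)" "F (- a, b) = F (a, b)"
    using abs[of a b] abs[of a "- b"] abs[of "- a" b] by simp_all
  have "2 * \<bar>a\<bar> \<le> 2"
    using tri[of "(a, b)" "(a, - b)"] hom[of "2 * a" "(1, 0)"] F1 1 assms(2) by simp
  then show "\<bar>a\<bar> \<le> 1" by simp
  have "2 * \<bar>b\<bar> \<le> 2"
    using tri[of "(a, b)" "(- a, b)"] hom[of "2 * b" "(0, 1)"] F1 1 assms(2) by simp
  then show "\<bar>b\<bar> \<le> 1" by simp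
qed

text \<open>The coordinate bounds make the set under the supremum bounded above by
  \<open>\<bar>c\<bar> + \<bar>d\<bar>\<close>.\<close>

lemma dual_norm_R2_le_iff:
  assumes "absolute_normalized_norm F"
  shows "dual_norm_R2 F (c, d) \<le> r \<longleftrightarrow> (\<forall>a b. F (a, b) \<le> 1 \<longrightarrow> \<bar>a * c\<bar> + \<bar>b * d\<bar> \<le> r)"
proof -
  let ?h = "\<lambda>(a, b). \<bar>a * c\<bar> + \<bar>b * d\<bar>"
  have "F (1, 0) \<le> 1" using assms by (simp add: absolute_normalized_norm_def)
  then have ne: "{p. F p \<le> 1} \<noteq> {}" by blast
  have "\<bar>a * c\<bar> + \<bar>b * d\<bar> \<le> \<bar>c\<bar> + \<bar>d\<bar>" if "F (a, b) \<le> 1" for a b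
    using absolute_normalized_norm_bounds_coordinates[OF assms that]
    by (simp add: abs_mult add_mono mult_left_le_one_le)
  then have "bdd_above (?h ` {p. F p \<le> 1})"
    by (intro bdd_aboveI2[where M = "\<bar>c\<bar> + \<bar>d\<bar>"]) auto
  then have "(SUP p\<in>{p. F p \<le> 1}. ?h p) \<le> r \<longleftrightarrow> (\<forall>p\<in>{p. F p \<le> 1}. ?h p \<le> r)"
    by (intro cSUP_le_iff ne)
  then show ?thesis by (auto simp: dual_norm_R2_def)
qed

text \<open>Testing at \<open>(1, 0)\<close>. For an ideal projection this gives
  contractivity.\<close>

lemma dual_norm_R2_ge_fst:
  assumes "absolute_normalized_norm F"
  shows "\<bar>c\<bar> \<le> dual_norm_R2 F (c, d)"
proof -
  have "F (1, 0) \<le> 1" using assms by (simp add: absolute_normalized_norm_def)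
  then have "\<bar>1 * c\<bar> + \<bar>0 * d\<bar> \<le> dual_norm_R2 F (c, d)"
    using dual_norm_R2_le_iff[OF assms, of c d] by blast
  then show ?thesis by simp
qed

text \<open>Extremality enters through the failure of \<open>(1, \<plusminus>\<delta>)\<close> to lie in the dual ball, which is
  witnessed by a single point of the ball of \<open>F\<close>.\<close>

lemma extreme_point_imp_snd_small:
  assumes F: "absolute_normalized_norm F"
    and ext: "(1, 0) extreme_point_of {p. dual_norm_R2 F p \<le> 1}" and \<delta>: "\<delta> > 0"
  obtains \<gamma> where "\<gamma> > 0"
    "\<And>s t. 1 - \<gamma> \<le> s \<Longrightarrow> 0 \<le> t \<Longrightarrow> dual_norm_R2 F (s, t) \<le> 1 \<Longrightarrow> t < \<delta>"
proof -
  have "(1, 0) \<in> open_segment (1, \<delta>) (1, - \<delta>)"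
    using \<delta> by (auto simp: in_segment intro!: exI[of _ "1/2"])
  then have "dual_norm_R2 F (1, \<delta>) > 1 \<or> dual_norm_R2 F (1, - \<delta>) > 1"
    using ext unfolding extreme_point_of_def mem_Collect_eq not_le[symmetric] by blast
  moreover have "dual_norm_R2 F (1, - \<delta>) \<le> 1 \<longleftrightarrow> dual_norm_R2 F (1, \<delta>) \<le> 1"
    unfolding dual_norm_R2_le_iff[OF F] by simp
  ultimately have "\<not> dual_norm_R2 F (1, \<delta>) \<le> 1" by linarith
  then obtain a b where ab: "F (a, b) \<le> 1" "\<bar>a\<bar> + \<bar>b\<bar> * \<delta> > 1"
    unfolding dual_norm_R2_le_iff[OF F] using \<delta> by (auto simp: abs_mult not_le)
  have a: "\<bar>a\<bar> \<le> 1" using absolute_normalized_norm_bounds_coordinates[OF F ab(1)] by simp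
  \<comment> \<open>Half of the excess over 1. As \<open>\<bar>a\<bar> \<le> 1\<close>, lowering the
    first coordinate from 1 to \<open>1 - \<gamma>\<close> costs at most this half.\<close>
  define \<gamma> where "\<gamma> = (\<bar>a\<bar> + \<bar>b\<bar> * \<delta> - 1) / 2"
  show ?thesis
  proof
    show "\<gamma> > 0" using ab by (simp add: \<gamma>_def)
    fix s t assume s: "1 - \<gamma> \<le> s" and t: "0 \<le> t" and le: "dual_norm_R2 F (s, t) \<le> 1"
    show "t < \<delta>"
    proof (rule ccontr)
      assume "\<not> t < \<delta>"
      then have 1: "\<bar>b\<bar> * \<delta> \<le> \<bar>b\<bar> * t" by (intro mult_left_mono) auto
      have "\<bar>a * s\<bar> + \<bar>b * t\<bar> \<le> 1" using le ab(1) dual_norm_R2_le_iff[OF F] by blast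
      then have 2: "\<bar>a\<bar> * \<bar>s\<bar> + \<bar>b\<bar> * t \<le> 1" using t by (simp add: abs_mult)
      have "\<bar>a\<bar> * (1 - \<gamma>) \<le> \<bar>a\<bar> * \<bar>s\<bar>" using s by (intro mult_left_mono) auto
      then have 3: "\<bar>a\<bar> - \<bar>a\<bar> * \<gamma> \<le> \<bar>a\<bar> * \<bar>s\<bar>" by (simp add: algebra_simps)
      have "\<bar>a\<bar> * \<gamma> \<le> \<gamma>" using a ab(2) by (simp add: \<gamma>_def mult_left_le_one_le)
      moreover have "2 * \<gamma> = \<bar>a\<bar> + \<bar>b\<bar> * \<delta> - 1" by (simp add: \<gamma>_def)
      ultimately have "2 * \<gamma> \<le> \<gamma>" using 1 2 3 by linarith
      then show False using \<open>\<gamma> > 0\<close> by simp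
    qed
  qed
qed

subsection \<open>Ideal projections\<close>

text \<open>With the next lemma, this identifies functionals on \<open>Y\<close> with the range of
  \<open>P\<close>: \<open>P f\<close> depends only on the restriction of \<open>f\<close> to
  \<open>Y\<close> and has the same restriction.\<close>

lemma annihilator_projection_cong:
  fixes P :: "('a::real_normed_vector \<Rightarrow>\<^sub>L real) \<Rightarrow> ('a \<Rightarrow>\<^sub>L real)" and f g :: "'a \<Rightarrow>\<^sub>L real"
  assumes "linear P" "{f. P f = 0} = annihilator Y" "\<And>y. y \<in> Y \<Longrightarrow> f y = g y"
  shows "P f = P g"
proof -
  have "f - g \<in> annihilator Y"
    using assms(3) by (simp add: annihilator_def blinfun.diff_left)
  then have "P (f - g) = 0" using assms(2) by blast
  then show ?thesis using assms(1) by (simp add: linear_diff)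
qed

lemma annihilator_projection_restrict:
  fixes P :: "('a::real_normed_vector \<Rightarrow>\<^sub>L real) \<Rightarrow> ('a \<Rightarrow>\<^sub>L real)" and f :: "'a \<Rightarrow>\<^sub>L real"
  assumes "linear P" "\<And>f. P (P f) = P f" "{f. P f = 0} = annihilator Y" "y \<in> Y"
  shows "P f y = f y"
proof -
  have "P (P f - f) = 0" using assms(1,2) by (simp add: linear_diff)
  then have "P f - f \<in> annihilator Y" using assms(3) by blast
  then show ?thesis using assms(4) by (simp add: annihilator_def blinfun.diff_left)
qed

text \<open>The adjoint of \<open>P\<close> maps \<open>z\<close> into the unit ball of the bidual of \<open>Y\<close>, so this is Goldstine's
  theorem for finitely many functionals on \<open>Y\<close>, identified with the range of \<open>P\<close>.\<close>

lemma contractive_projection_approximation: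
  fixes P :: "('a::real_normed_vector \<Rightarrow>\<^sub>L real) \<Rightarrow> ('a \<Rightarrow>\<^sub>L real)"
  assumes Y: "subspace Y" and P: "linear P" "\<And>f. P (P f) = P f" "{f. P f = 0} = annihilator Y"
    and contr: "\<And>f. norm (P f) \<le> norm f"
    and z: "norm z \<le> 1" and G: "finite G" "\<And>f. f \<in> G \<Longrightarrow> P f = f" and \<eta>: "\<eta> > 0"
  obtains y where "y \<in> unit_ball Y" "\<And>f. f \<in> G \<Longrightarrow> \<bar>f y - f z\<bar> < \<eta>"
proof -
  define M where "M = (\<Sum>f\<in>G. norm f)"
  have bound: "\<bar>blinfun_apply h x\<bar> \<le> norm h" if "norm x \<le> 1" for h :: "'a \<Rightarrow>\<^sub>L real" and x
    using norm_blinfun[of h x] mult_left_mono[OF that norm_ge_zero[of h]] by simp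
  let ?G = "blinfun_apply ` G"
  obtain y where "y \<in> unit_ball Y" "\<And>f. f \<in> ?G \<Longrightarrow> \<bar>f y - f z\<bar> < \<eta>"
  proof (rule Helly_approximation[where C = "unit_ball Y" and G = ?G and a = "\<lambda>f. f z"
        and M = M and \<eta> = \<eta>])
    have "unit_ball Y = Y \<inter> cball 0 1" by (auto simp: unit_ball_def)
    then show "convex (unit_ball Y)"
      using Y by (simp add: convex_Int subspace_imp_convex)
    show "unit_ball Y \<noteq> {}" using subspace_0[OF Y] by (auto simp: unit_ball_def)
    show "finite ?G" using G by simp
    show "linear f" if "f \<in> ?G" for f
      using that by (auto intro: bounded_linear.linear blinfun.bounded_linear_right)
    show "\<bar>f y\<bar> \<le> M" if f: "f \<in> ?G" and y: "y \<in> unit_ball Y" for f y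
    proof -
      obtain h where h: "h \<in> G" "f = blinfun_apply h" using f by blast
      then have "\<bar>f y\<bar> \<le> norm h" using bound y by (simp add: unit_ball_def)
      also have "\<dots> \<le> M" unfolding M_def using h(1) G(1) by (intro member_le_sum) auto
      finally show ?thesis .
    qed
    show "(\<Sum>f\<in>?G. c f * f z) \<le> B" if B: "\<And>y. y \<in> unit_ball Y \<Longrightarrow> (\<Sum>f\<in>?G. c f * f y) \<le> B" for c B
    proof -
      define h where "h = (\<Sum>f\<in>G. c (blinfun_apply f) *\<^sub>R f)"
      have h: "h x = (\<Sum>f\<in>?G. c f * f x)" for x
        by (subst sum.reindex)
          (auto simp: h_def inj_on_def blinfun_apply_inject blinfun.sum_left blinfun.scaleR_left)
      have Ph: "P h = h"
        using G(2) P(1) by (simp add: h_def linear_sum linear_scale)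
      have hB: "h y \<le> B" if "y \<in> unit_ball Y" for y
        using B[OF that] h by simp
      have B0: "B \<ge> 0" using hB[of 0] subspace_0[OF Y] by (simp add: unit_ball_def)
      have hn: "h y \<le> B * norm y" if "y \<in> Y" for y
      proof (cases "y = 0")
        case False
        then have "h (y /\<^sub>R norm y) \<le> B"
          using that by (intro hB) (auto simp: unit_ball_def subspace_scale[OF Y])
        then show ?thesis using False by (simp add: blinfun.scaleR_right field_simps)
      qed simp
      \<comment> \<open>So far \<open>h\<close> is controlled only on \<open>Y\<close>. An extension
        \<open>k\<close> of its restriction has norm at most \<open>B\<close>, and
        \<open>P k = P h = h\<close> carries this bound over to \<open>h\<close>.\<close>
      obtain k :: "'a \<Rightarrow>\<^sub>L real" where k: "norm k \<le> B" "\<And>y. y \<in> Y \<Longrightarrow> k y = h y"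
      proof (rule Hahn_Banach_extension[OF Y B0, where f = "blinfun_apply h"])
        show "\<bar>h y\<bar> \<le> B * norm y" if "y \<in> Y" for y
          using hn[OF that] hn[OF subspace_neg[OF Y that]] by (simp add: blinfun.minus_right)
      qed (auto simp: blinfun.add_right blinfun.scaleR_right)
      have "P k = P h" using P k(2) by (intro annihilator_projection_cong[of P Y]) auto
      then have "norm h \<le> B" using contr[of k] k(1) Ph by simp
      then show ?thesis using bound[OF z, of h] h by simp
    qed
    show "\<eta> > 0" by (rule \<eta>)
  qed blast
  then show ?thesis using that by simp
qed

text \<open>The common core of both properties: \<open>\<epsilon>'\<close> is fixed before
  \<open>z\<close>, \<open>G\<close> and \<open>\<eta>\<close>, so \<open>z\<close> can come from
  the property of the whole space, applied to a set defined by the functionals in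
  \<open>G\<close>.\<close>

lemma F_ideal_transfer:
  fixes P :: "('a::real_normed_vector \<Rightarrow>\<^sub>L real) \<Rightarrow> ('a \<Rightarrow>\<^sub>L real)"
  assumes F: "absolute_normalized_norm F"
    and ext: "(1, 0) extreme_point_of {p. dual_norm_R2 F p \<le> 1}"
    and Y: "subspace Y" and P: "linear P" "\<And>f. P (P f) = P f" "{f. P f = 0} = annihilator Y"
    and nrm: "\<And>f. norm f = dual_norm_R2 F (norm (P f), norm (f - P f))"
    and x: "x \<in> Y" "norm x = 1" and \<epsilon>: "\<epsilon> > 0"
  obtains \<epsilon>' where "\<epsilon>' > 0"
    "\<And>z G \<eta>. \<lbrakk>norm z \<le> 1; norm (x - z) \<ge> 2 - \<epsilon>'; finite G; \<And>f. f \<in> G \<Longrightarrow> P f = f; \<eta> > 0\<rbrakk>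
      \<Longrightarrow> \<exists>y\<in>unit_ball Y. (\<forall>f\<in>G. \<bar>f y - f z\<bar> < \<eta>) \<and> norm (x - y) \<ge> 2 - \<epsilon>"
proof -
  have contr: "norm (P f) \<le> norm f" for f
    using dual_norm_R2_ge_fst[OF F, of "norm (P f)" "norm (f - P f)"] nrm[of f] by simp
  have "\<epsilon> / 3 > 0" using \<epsilon> by simp
  then obtain \<gamma> where \<gamma>: "\<gamma> > 0"
    "\<And>s t. 1 - \<gamma> \<le> s \<Longrightarrow> 0 \<le> t \<Longrightarrow> dual_norm_R2 F (s, t) \<le> 1 \<Longrightarrow> t < \<epsilon> / 3"
    using extreme_point_imp_snd_small[OF F ext] by blast
  have bound: "\<bar>blinfun_apply h v\<bar> \<le> 1" if "norm h \<le> 1" "norm v \<le> 1" for h :: "'a \<Rightarrow>\<^sub>L real" and v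
    using norm_blinfun[of h v] mult_mono[OF that] by simp
  show ?thesis
  proof
    \<comment> \<open>\<open>\<gamma>\<close> forces \<open>g x\<close> close to 1. The thirds of
      \<open>\<epsilon>\<close> pay for the distance of \<open>z\<close> from \<open>x\<close>, for
      replacing \<open>g\<close> by \<open>P g\<close> at \<open>z\<close>, and for replacing
      \<open>z\<close> by \<open>y\<close>.\<close>
    show "min \<gamma> (\<epsilon> / 3) > 0" using \<gamma> \<epsilon> by simp
    fix z G and \<eta> :: real
    assume z: "norm z \<le> 1" "norm (x - z) \<ge> 2 - min \<gamma> (\<epsilon> / 3)"
      and G: "finite G" "\<And>f. f \<in> G \<Longrightarrow> P f = f" and \<eta>: "\<eta> > 0"
    obtain g :: "'a \<Rightarrow>\<^sub>L real" where g: "norm g \<le> 1" "g (x - z) = norm (x - z)"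
      using norming_functional .
    have Pgx: "P g x = g x" using P x(1) by (rule annihilator_projection_restrict)
    have Pg: "norm (P g) \<le> 1" using contr[of g] g(1) by linarith
    have "g x \<ge> 1 - \<gamma>"
      using g z(2) bound[OF g(1) z(1)] by (simp add: blinfun.diff_right)
    moreover have "P g x \<le> norm (P g)" using norm_blinfun[of "P g" x] x(2) by simp
    ultimately have "norm (g - P g) < \<epsilon> / 3"
      using nrm[of g] g(1) Pgx by (intro \<gamma>(2)[of "norm (P g)"]) auto
    then have "\<bar>(g - P g) z\<bar> < \<epsilon> / 3"
      using norm_blinfun[of "g - P g" z] mult_left_mono[OF z(1) norm_ge_zero[of "g - P g"]] by simp
    then have 1: "\<bar>g z - P g z\<bar> < \<epsilon> / 3" by (simp add: blinfun.diff_left)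
    obtain y where y: "y \<in> unit_ball Y" "\<And>f. f \<in> insert (P g) G \<Longrightarrow> \<bar>f y - f z\<bar> < min \<eta> (\<epsilon> / 3)"
      using contractive_projection_approximation[OF Y P contr z(1), of "insert (P g) G" "min \<eta> (\<epsilon> / 3)"]
        G \<eta> \<epsilon> P(2) by auto
    have 2: "\<bar>P g y - P g z\<bar> < \<epsilon> / 3" using y(2)[of "P g"] by simp
    have "norm (x - z) = g x - g z" using g(2) by (simp add: blinfun.diff_right)
    then have "2 - \<epsilon> \<le> P g x - P g y" using 1 2 z(2) Pgx by linarith
    also have "\<dots> \<le> norm (P g) * norm (x - y)"
      using norm_blinfun[of "P g" "x - y"] by (simp add: blinfun.diff_right)
    also have "\<dots> \<le> norm (x - y)" using Pg by (simp add: mult_left_le_one_le)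
    finally show "\<exists>y\<in>unit_ball Y. (\<forall>f\<in>G. \<bar>f y - f z\<bar> < \<eta>) \<and> norm (x - y) \<ge> 2 - \<epsilon>"
      using y by auto
  qed
qed

subsection \<open>Transfer of the diameter two properties\<close>

lemma dual_norm_bound:
  assumes Y: "subspace Y" and f: "f \<in> dual_space Y" and y: "y \<in> Y"
  shows "\<bar>f y\<bar> \<le> dual_norm Y f * norm y"
proof -
  have scale: "f (c *\<^sub>R x) = c * f x" if "x \<in> Y" for c x
    using f that by (simp add: dual_space_def)
  obtain K where K: "\<And>x. x \<in> Y \<Longrightarrow> \<bar>f x\<bar> \<le> K * norm x" using f unfolding dual_space_def by blast
  have "\<bar>f x\<bar> \<le> \<bar>K\<bar>" if "x \<in> unit_ball Y" for x
  proof -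
    have "\<bar>f x\<bar> \<le> \<bar>K\<bar> * norm x"
      using K[of x] that mult_right_mono[OF abs_ge_self norm_ge_zero, of K x] by (simp add: unit_ball_def)
    also have "\<dots> \<le> \<bar>K\<bar> * 1" using that by (intro mult_left_mono) (auto simp: unit_ball_def)
    finally show ?thesis by simp
  qed
  then have bdd: "bdd_above ((\<lambda>x. \<bar>f x\<bar>) ` unit_ball Y)" by (intro bdd_aboveI2)
  show ?thesis
  proof (cases "y = 0")
    case True
    then show ?thesis using scale[OF y, of 0] by simp
  next
    case False
    then have "\<bar>f (y /\<^sub>R norm y)\<bar> \<le> dual_norm Y f"
      unfolding dual_norm_def using y bdd
      by (intro cSUP_upper) (auto simp: unit_ball_def subspace_scale[OF Y])
    then show ?thesis using False scale[OF y] by (simp add: abs_mult field_simps)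
  qed
qed

text \<open>Hahn-Banach bounds the norm of the extension from above; agreement with \<open>f\<close>
  on the ball of \<open>Y\<close> bounds it from below.\<close>

lemma dual_space_extension:
  assumes Y: "subspace Y" and f: "f \<in> dual_space Y"
  obtains g :: "'a::real_normed_vector \<Rightarrow>\<^sub>L real" where "norm g = dual_norm Y f" "\<And>y. y \<in> Y \<Longrightarrow> g y = f y"
proof -
  have ne: "unit_ball Y \<noteq> {}" using subspace_0[OF Y] by (auto simp: unit_ball_def)
  have "0 \<in> unit_ball Y" using subspace_0[OF Y] by (simp add: unit_ball_def)
  have K: "dual_norm Y f \<ge> 0"
  proof (cases "\<exists>y\<in>Y. y \<noteq> 0")
    case True
    then obtain y where "y \<in> Y" "y \<noteq> 0" by blast
    then show ?thesis using dual_norm_bound[OF Y f, of y] abs_ge_zero[of "f y"]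
      by (smt (verit) mult_neg_pos zero_less_norm_iff)
  next
    case False
    then have "unit_ball Y = {0}" using \<open>0 \<in> unit_ball Y\<close> by (auto simp: unit_ball_def)
    then show ?thesis by (simp add: dual_norm_def)
  qed
  obtain g :: "'a \<Rightarrow>\<^sub>L real" where g: "norm g \<le> dual_norm Y f" "\<And>y. y \<in> Y \<Longrightarrow> g y = f y"
    using Hahn_Banach_extension[OF Y K, of f] f dual_norm_bound[OF Y f]
    by (auto simp: dual_space_def)
  have "dual_norm Y f \<le> norm g"
    unfolding dual_norm_def using ne
  proof (rule cSUP_least)
    fix y assume y: "y \<in> unit_ball Y"
    then have "\<bar>f y\<bar> \<le> norm g * norm y" using norm_blinfun[of g y] g(2) by (simp add: unit_ball_def)
    also have "\<dots> \<le> norm g * 1" using y by (intro mult_left_mono) (auto simp: unit_ball_def)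
    finally show "\<bar>f y\<bar> \<le> norm g" by simp
  qed
  then show ?thesis using g that[of g] by simp
qed

section \<open>Weak neighbourhoods given by finitely many functionals\<close>

text \<open>Induction over the generation of the topology: an intersection merges the two finite
  sets and takes the smaller radius, and a subbasic set needs one functional.\<close>

lemma openin_weak_topology_neighbourhood:
  assumes "openin (weak_topology Y) W" "x \<in> W"
  obtains G \<delta> where "finite G" "G \<subseteq> dual_space Y" "\<delta> > 0"
    "\<And>y. y \<in> Y \<Longrightarrow> (\<And>f. f \<in> G \<Longrightarrow> \<bar>f y - f x\<bar> < \<delta>) \<Longrightarrow> y \<in> W"
proof -
  have "generate_topology_on {{x \<in> Y. f x \<in> V} | f V. f \<in> dual_space Y \<and> open V} W"
    using assms(1) unfolding weak_topology_def by (simp add: openin_topology_generated_by_iff)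
  then have "\<exists>G \<delta>. finite G \<and> G \<subseteq> dual_space Y \<and> \<delta> > 0 \<and>
      (\<forall>y\<in>Y. (\<forall>f\<in>G. \<bar>f y - f x\<bar> < \<delta>) \<longrightarrow> y \<in> W)"
    using \<open>x \<in> W\<close>
  proof induction
    case Empty
    then show ?case by simp
  next
    case (Int a b)
    then have "x \<in> a" "x \<in> b" by blast+
    obtain G \<delta> where G: "finite G" "G \<subseteq> dual_space Y" "\<delta> > 0"
        "\<forall>y\<in>Y. (\<forall>f\<in>G. \<bar>f y - f x\<bar> < \<delta>) \<longrightarrow> y \<in> a"
      using Int.IH(1)[OF \<open>x \<in> a\<close>] by blast
    obtain H \<gamma> where H: "finite H" "H \<subseteq> dual_space Y" "\<gamma> > 0"
        "\<forall>y\<in>Y. (\<forall>f\<in>H. \<bar>f y - f x\<bar> < \<gamma>) \<longrightarrow> y \<in> b"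
      using Int.IH(2)[OF \<open>x \<in> b\<close>] by blast
    show ?case
    proof (intro exI conjI ballI impI)
      show "finite (G \<union> H)" "G \<union> H \<subseteq> dual_space Y" "min \<delta> \<gamma> > 0" using G H by auto
      show "y \<in> a \<inter> b" if "y \<in> Y" "\<forall>f\<in>G \<union> H. \<bar>f y - f x\<bar> < min \<delta> \<gamma>" for y
        using that G(4) H(4) by simp
    qed
  next
    case (UN K)
    then obtain k where "k \<in> K" "x \<in> k" by blast
    then show ?case using UN.IH[of k] by (meson UnionI)
  next
    case (Basis s)
    then obtain f V where s: "s = {x \<in> Y. f x \<in> V}" "f \<in> dual_space Y" "open V" by blast
    then obtain e where "e > 0" "\<And>r. \<bar>r - f x\<bar> < e \<Longrightarrow> r \<in> V"
      using Basis by (auto simp: open_dist dist_real_def)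
    then show ?case using s by (intro exI[of _ "{f}"] exI[of _ e]) auto
  qed
  then obtain G \<delta> where "finite G" "G \<subseteq> dual_space Y" "\<delta> > 0"
    "\<forall>y\<in>Y. (\<forall>f\<in>G. \<bar>f y - f x\<bar> < \<delta>) \<longrightarrow> y \<in> W" by blast
  then show ?thesis by (intro that[of G \<delta>]) simp_all
qed

lemma openin_weak_topology_basic:
  fixes Y :: "'a::real_normed_vector set"
  assumes "finite G" "G \<subseteq> dual_space Y"
  shows "openin (weak_topology Y) {y \<in> Y. \<forall>f\<in>G. \<bar>f y - f x\<bar> < \<delta>}"
  using assms
proof (induction G rule: finite_induct)
  case empty
  show ?case using openin_topspace[of "weak_topology Y"] by (simp add: topspace_weak_topology)
next
  case (insert f G)
  have "openin (weak_topology Y) {y \<in> Y. f y \<in> ball (f x) \<delta>}"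
    unfolding weak_topology_def using insert.prems
    by (intro topology_generated_by_Basis) (blast intro: open_ball)
  then have "openin (weak_topology Y)
      ({y \<in> Y. f y \<in> ball (f x) \<delta>} \<inter> {y \<in> Y. \<forall>f\<in>G. \<bar>f y - f x\<bar> < \<delta>})"
    using insert by (intro openin_Int) auto
  also have "{y \<in> Y. f y \<in> ball (f x) \<delta>} \<inter> {y \<in> Y. \<forall>f\<in>G. \<bar>f y - f x\<bar> < \<delta>} =
      {y \<in> Y. \<forall>f\<in>insert f G. \<bar>f y - f x\<bar> < \<delta>}"
    by (auto simp: dist_real_def abs_minus_commute)
  finally show ?case .
qed

section \<open>Passage to the ideal, for slices and for weakly open sets\<close>

lemma F_ideal_DLD2P:
  fixes Y :: "'a::real_normed_vector set"
  assumes F: "absolute_normalized_norm F"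
    and ext: "(1, 0) extreme_point_of {p. dual_norm_R2 F p \<le> 1}"
    and ideal: "F_ideal F Y" and X: "DLD2P (UNIV :: 'a set)"
  shows "DLD2P Y"
  unfolding DLD2P_def
proof (intro allI impI ballI)
  fix S x and \<epsilon> :: real
  assume S: "is_slice Y S" and x: "x \<in> S \<inter> unit_sphere Y" and \<epsilon>: "\<epsilon> > 0"
  obtain P where Y: "subspace Y" and P: "linear P" "\<And>f. P (P f) = P f" "{f. P f = 0} = annihilator Y"
      and nrm: "\<And>f. norm f = dual_norm_R2 F (norm (P f), norm (f - P f))"
    using ideal unfolding F_ideal_def by blast
  have xY: "x \<in> Y" "norm x = 1" using x by (auto simp: unit_sphere_def)
  obtain \<epsilon>' where \<epsilon>': "\<epsilon>' > 0" and transfer: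
    "\<And>z G \<eta>. \<lbrakk>norm z \<le> 1; norm (x - z) \<ge> 2 - \<epsilon>'; finite G; \<And>f. f \<in> G \<Longrightarrow> P f = f; \<eta> > 0\<rbrakk>
      \<Longrightarrow> \<exists>y\<in>unit_ball Y. (\<forall>f\<in>G. \<bar>blinfun_apply f y - f z\<bar> < \<eta>) \<and> norm (x - y) \<ge> 2 - \<epsilon>"
    using F_ideal_transfer[OF F ext Y P nrm xY \<epsilon>] by blast
  obtain f \<alpha> where f: "f \<in> dual_space Y" "dual_norm Y f = 1" and \<alpha>: "\<alpha> > 0" and Sf: "S = slice Y f \<alpha>"
    using S by (auto simp: is_slice_def)
  obtain k :: "'a \<Rightarrow>\<^sub>L real" where k: "norm k = 1" "\<And>y. y \<in> Y \<Longrightarrow> k y = f y"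
    using dual_space_extension[OF Y f(1)] f(2) by metis
  define h where "h = P k"
  have h: "h y = f y" if "y \<in> Y" for y
    using annihilator_projection_restrict[OF P that] k(2)[OF that] by (simp add: h_def)
  have h1: "norm h = 1"
  \<comment> \<open>A slice requires norm exactly 1: \<open>P\<close> is contractive, and
    \<open>h\<close> still extends \<open>f\<close>.\<close>
  proof (rule antisym)
    show "norm h \<le> 1"
      using dual_norm_R2_ge_fst[OF F, of "norm (P k)" "norm (k - P k)"] nrm[of k] k(1)
      by (simp add: h_def)
    have "dual_norm Y f \<le> norm h" unfolding dual_norm_def
    proof (rule cSUP_least)
      show "unit_ball Y \<noteq> {}" using subspace_0[OF Y] by (auto simp: unit_ball_def)
      show "\<bar>f y\<bar> \<le> norm h" if "y \<in> unit_ball Y" for y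
        using that norm_blinfun[of h y] h mult_left_mono[OF _ norm_ge_zero[of h], of "norm y" 1]
        by (force simp: unit_ball_def)
    qed
    then show "1 \<le> norm h" using f(2) by simp
  qed
  have "is_slice UNIV (slice UNIV (blinfun_apply h) \<alpha>)"
    unfolding is_slice_def using h1 \<alpha>
    by (intro exI[of _ "blinfun_apply h"] exI[of _ \<alpha>])
      (auto simp: dual_norm_UNIV dual_space_UNIV intro: blinfun.bounded_linear_right)
  moreover have "x \<in> slice UNIV (blinfun_apply h) \<alpha> \<inter> unit_sphere UNIV"
    using x h by (auto simp: Sf slice_def unit_ball_def unit_sphere_def)
  ultimately obtain z where z: "z \<in> slice UNIV (blinfun_apply h) \<alpha>" "norm (x - z) \<ge> 2 - \<epsilon>'"
    using X \<epsilon>' unfolding DLD2P_def by blast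
  have z': "norm z \<le> 1" "h z - (1 - \<alpha>) > 0" using z(1) by (auto simp: slice_def unit_ball_def)
  \<comment> \<open>The tolerance is the margin by which \<open>z\<close> lies inside the slice, so
    \<open>y\<close> cannot leave it.\<close>
  obtain y where y: "y \<in> unit_ball Y" "\<bar>h y - h z\<bar> < h z - (1 - \<alpha>)" "norm (x - y) \<ge> 2 - \<epsilon>"
    using transfer[OF z'(1) z(2), of "{h}", OF _ _ z'(2)] P(2) by (auto simp: h_def)
  have "y \<in> S" using y h[of y] by (auto simp: Sf slice_def unit_ball_def)
  then show "\<exists>y\<in>S. norm (x - y) \<ge> 2 - \<epsilon>" using y(3) by blast
qed

lemma F_ideal_DD2P:
  fixes Y :: "'a::real_normed_vector set"
  assumes F: "absolute_normalized_norm F"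
    and ext: "(1, 0) extreme_point_of {p. dual_norm_R2 F p \<le> 1}"
    and ideal: "F_ideal F Y" and X: "DD2P (UNIV :: 'a set)"
  shows "DD2P Y"
  unfolding DD2P_def
proof (intro allI impI ballI)
  fix U x and \<epsilon> :: real
  assume U: "openin (subtopology (weak_topology Y) (unit_ball Y)) U \<and> U \<noteq> {}"
    and x: "x \<in> U \<inter> unit_sphere Y" and \<epsilon>: "\<epsilon> > 0"
  obtain P where Y: "subspace Y" and P: "linear P" "\<And>f. P (P f) = P f" "{f. P f = 0} = annihilator Y"
      and nrm: "\<And>f. norm f = dual_norm_R2 F (norm (P f), norm (f - P f))"
    using ideal unfolding F_ideal_def by blast
  have xY: "x \<in> Y" "norm x = 1" using x by (auto simp: unit_sphere_def)
  obtain \<epsilon>' where \<epsilon>': "\<epsilon>' > 0" and transfer: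
    "\<And>z G \<eta>. \<lbrakk>norm z \<le> 1; norm (x - z) \<ge> 2 - \<epsilon>'; finite G; \<And>f. f \<in> G \<Longrightarrow> P f = f; \<eta> > 0\<rbrakk>
      \<Longrightarrow> \<exists>y\<in>unit_ball Y. (\<forall>f\<in>G. \<bar>blinfun_apply f y - f z\<bar> < \<eta>) \<and> norm (x - y) \<ge> 2 - \<epsilon>"
    using F_ideal_transfer[OF F ext Y P nrm xY \<epsilon>] by blast
  obtain W where W: "openin (weak_topology Y) W" "U = W \<inter> unit_ball Y"
    using U by (auto simp: openin_subtopology)
  obtain G \<delta> where G: "finite G" "G \<subseteq> dual_space Y" "\<delta> > 0" and GW:
    "\<And>y. y \<in> Y \<Longrightarrow> (\<And>f. f \<in> G \<Longrightarrow> \<bar>f y - f x\<bar> < \<delta>) \<Longrightarrow> y \<in> W"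
    using openin_weak_topology_neighbourhood[OF W(1)] x W(2) by blast
  have "\<exists>h::'a \<Rightarrow>\<^sub>L real. P h = h \<and> (\<forall>y\<in>Y. h y = f y)" if f: "f \<in> G" for f
  proof -
    obtain k :: "'a \<Rightarrow>\<^sub>L real" where "\<And>y. y \<in> Y \<Longrightarrow> k y = f y"
      using dual_space_extension[OF Y] f G(2) by blast
    then show ?thesis
      using P(2) annihilator_projection_restrict[OF P] by (intro exI[of _ "P k"]) auto
  qed
  then obtain E :: "('a \<Rightarrow> real) \<Rightarrow> 'a \<Rightarrow>\<^sub>L real" where E: "\<And>f. f \<in> G \<Longrightarrow> P (E f) = E f"
    "\<And>f y. f \<in> G \<Longrightarrow> y \<in> Y \<Longrightarrow> E f y = f y" by metis
  \<comment> \<open>Half the radius is spent between \<open>x\<close> and \<open>z\<close>, the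
    other half between \<open>z\<close> and \<open>y\<close>. The functionals \<open>E f\<close> lie
    in the range of \<open>P\<close>, as the transfer demands.\<close>
  define V where "V = {z \<in> UNIV. \<forall>f\<in>(\<lambda>f. blinfun_apply (E f)) ` G. \<bar>f z - f x\<bar> < \<delta> / 2}"
  have "openin (weak_topology UNIV) V"
    unfolding V_def using G(1)
    by (intro openin_weak_topology_basic) (auto simp: dual_space_UNIV intro: blinfun.bounded_linear_right)
  then have "openin (subtopology (weak_topology UNIV) (unit_ball UNIV)) (V \<inter> unit_ball UNIV)"
    by (auto simp: openin_subtopology)
  moreover have "x \<in> (V \<inter> unit_ball UNIV) \<inter> unit_sphere UNIV"
    using xY G(3) by (auto simp: V_def unit_ball_def unit_sphere_def)
  ultimately obtain z where z: "z \<in> V \<inter> unit_ball UNIV" "norm (x - z) \<ge> 2 - \<epsilon>'"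
    using X \<epsilon>' unfolding DD2P_def by blast
  have z1: "norm z \<le> 1" using z(1) by (simp add: unit_ball_def)
  obtain y where y: "y \<in> unit_ball Y" "\<And>f. f \<in> G \<Longrightarrow> \<bar>E f y - E f z\<bar> < \<delta> / 2" "norm (x - y) \<ge> 2 - \<epsilon>"
  proof -
    have "P f = f" if "f \<in> E ` G" for f using E(1) that by auto
    then have "\<exists>y\<in>unit_ball Y. (\<forall>f\<in>E ` G. \<bar>f y - f z\<bar> < \<delta> / 2) \<and> norm (x - y) \<ge> 2 - \<epsilon>"
      using G by (intro transfer[OF z1 z(2)]) auto
    then show ?thesis using that by blast
  qed
  have yY: "y \<in> Y" using y(1) by (simp add: unit_ball_def)
  have "\<bar>f y - f x\<bar> < \<delta>" if "f \<in> G" for f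
  proof -
    have "\<bar>E f z - E f x\<bar> < \<delta> / 2" using z(1) that by (auto simp: V_def)
    then have "\<bar>E f y - E f x\<bar> < \<delta>" using y(2)[OF that] by linarith
    then show ?thesis using E(2)[OF that] yY xY(1) by simp
  qed
  then have "y \<in> U" using GW[OF yY] W(2) y(1) by blast
  then show "\<exists>y\<in>U. norm (x - y) \<ge> 2 - \<epsilon>" using y(3) by blast
qed

theorem theorem3p2:
  fixes F :: "real \<times> real \<Rightarrow> real"
    and Y :: "'a::banach set"
  assumes "(UNIV :: 'a set) \<noteq> {0}"
    and "absolute_normalized_norm F"
    and "(1, 0) extreme_point_of {p. dual_norm_R2 F p \<le> 1}"
    and "F_ideal F Y"
  shows "(DD2P (UNIV :: 'a set) \<longrightarrow> DD2P Y) \<and> (DLD2P (UNIV :: 'a set) \<longrightarrow> DLD2P Y)"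
  using F_ideal_DD2P[OF assms(2-4)] F_ideal_DLD2P[OF assms(2-4)] by blast

end
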